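(* Let $K, M, N, L$ be positive integers, let $M_{\mathrm{tot}} = KM$, and let $\sigma^2>0$. For each $n \in \{1,\dots,N\}$ let $\epsilon_n\in(0,1)$ and let $\mathbf{R}_n=\mathrm{bdiag}(\mathbf{R}_{1n},\dots,\mathbf{R}_{Kn})\in\mathbb{C}^{M_{\mathrm{tot}}\times M_{\mathrm{tot}}}$ be block-diagonal, where each $\mathbf{R}_{kn}\in\mathbb{C}^{M\times M}$ is Hermitian positive semidefinite. Let $\mathbf{x}_n = a_n\mathbf{h}_n$ with $a_n\sim\mathrm{Bernoulli}(\epsilon_n)$ and $\mathbf{h}_n\sim\mathcal{CN}(\mathbf{0},\mathbf{R}_n)$ independent. Define the state evolution with the MMSE denoiser as follows: $$\bm{\Sigma}^0=\sigma^2\mathbf{I}+\frac{1}{L}\sum_{n=1}^N \mathbf{R}_n,$$ and for $t\ge 0$, $$\bm{\Sigma}^{t+1}=\sigma^2\mathbf{I}+\frac{1}{L}\sum_{n=1}^N\mathbb{E}\Big[\big(\mathbf{g}_{t,n}(\mathbf{x}_n+\mathbf{v}^t)-\mathbf{x}_n\big)\big(\mathbf{g}_{t,n}(\mathbf{x}_n+\mathbf{v}^t)-\mathbf{x}_n\big)^H\Big],$$ where $\mathbf{v}^t\sim\mathcal{CN}(\mathbf{0},\bm{\Sigma}^t)$ is independent of $\mathbf{x}_n$, and $\mathbf{g}_{t,n}(\bm{\xi})=\mathbb{E}[\mathbf{x}_n\mid \mathbf{x}_n+\mathbf{v}^t=\bm{\xi}]$ is the MMSE denoiser, explicitly $$\mathbf{g}_{t,n}(\bm{\xi})=\Big(1+\tfrac{1-\epsilon_n}{\epsilon_n}\tfrac{|\mathbf{R}_n+\bm{\Sigma}^t|}{|\bm{\Sigma}^t|}\exp\big(-\bm{\xi}^H\bm{\Omega}_n^t\bm{\xi}\big)\Big)^{-1}\mathbf{R}_n(\mathbf{R}_n+\bm{\Sigma}^t)^{-1}\bm{\xi},\qquad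 \bm{\Omega}_n^t=(\bm{\Sigma}^t)^{-1}-(\mathbf{R}_n+\bm{\Sigma}^t)^{-1},$$ with $|\cdot|$ denoting the determinant. Then for every $t\ge 0$, $\bm{\Sigma}^t$ is block-diagonal with the same block structure, i.e., $\bm{\Sigma}^t=\mathrm{bdiag}(\bm{\Sigma}^t_1,\dots,\bm{\Sigma}^t_K)$ with $\bm{\Sigma}^t_k\in\mathbb{C}^{M\times M}$.
   Context: $\mathrm{bdiag}(\mathbf{A}_1,\dots,\mathbf{A}_K)$ denotes the block-diagonal matrix with diagonal blocks $\mathbf{A}_1,\dots,\mathbf{A}_K$. $\mathcal{CN}(\mathbf{0},\mathbf{C})$ denotes the circularly-symmetric complex Gaussian distribution with covariance $\mathbf{C}$. The expectation in the state evolution is over the joint distribution of $\mathbf{x}_n$ and $\mathbf{v}^t$; $(\cdot)^H$ is the conjugate transpose. *)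

theory Defs
  imports "HOL-Probability.Probability"
begin

text \<open>Complex vectors of length Mtot = K*M are indexed by pairs (k,i) with
  k ranging over a finite type of size K (block index) and i over a finite type of
  size M (index within a block).  Matrices are complex^'n^'n.\<close>

type_synonym ('n) cvec = "complex ^ 'n"
type_synonym ('n) cmat = "complex ^ 'n ^ 'n"

definition cadj :: "complex ^ 'n ^ 'n \<Rightarrow> complex ^ 'n ^ 'n" where
  "cadj A = (\<chi> i j. cnj (A $ j $ i))"

definition hermitian :: "complex ^ 'n ^ 'n \<Rightarrow> bool" where
  "hermitian A \<longleftrightarrow> cadj A = A"

definition qform :: "complex ^ 'n ^ 'n \<Rightarrow> complex ^ 'n \<Rightarrow> complex" where
  "qform A x = (\<Sum>i\<in>UNIV. cnj (x $ i) * (A *v x) $ i)"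

definition psd :: "complex ^ 'n ^ 'n \<Rightarrow> bool" where
  "psd A \<longleftrightarrow> (\<forall>x. qform A x \<in> \<real> \<and> 0 \<le> Re (qform A x))"

definition outer :: "complex ^ 'n \<Rightarrow> complex ^ 'n ^ 'n" where
  "outer u = (\<chi> i j. u $ i * cnj (u $ j))"

definition dblock :: "complex ^ ('k::finite \<times> 'm::finite) ^ ('k \<times> 'm) \<Rightarrow> 'k \<Rightarrow> complex ^ 'm ^ 'm" where
  "dblock A k = (\<chi> i j. A $ (k, i) $ (k, j))"

definition is_bdiag :: "complex ^ ('k::finite \<times> 'm::finite) ^ ('k \<times> 'm) \<Rightarrow> bool" where
  "is_bdiag A \<longleftrightarrow> (\<forall>k k' i j. k \<noteq> k' \<longrightarrow> A $ (k, i) $ (k', j) = 0)"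

definition std_cgauss :: "(complex ^ 'n) measure" where
  "std_cgauss = density lborel
     (\<lambda>z. ennreal (\<Prod>i\<in>UNIV. exp (- (cmod (z $ i))\<^sup>2) / pi))"

text \<open>CN(0,C) for Hermitian PSD C: law of A z with z ~ CN(0,I) and A A^H = C.\<close>
definition cgauss :: "complex ^ 'n ^ 'n \<Rightarrow> (complex ^ 'n) measure" where
  "cgauss C = distr std_cgauss borel (\<lambda>z. (SOME A. A ** cadj A = C) *v z)"

text \<open>MMSE denoiser g(xi) for x = a h, a ~ Bernoulli(eps), h ~ CN(0,R),
  observed in noise CN(0,S) (explicit formula).\<close>
definition mmse_g :: "real \<Rightarrow> complex ^ 'n ^ 'n \<Rightarrow> complex ^ 'n ^ 'n
    \<Rightarrow> complex ^ 'n \<Rightarrow> complex ^ 'n" where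
  "mmse_g eps R S xi =
     (let Om = matrix_inv S - matrix_inv (R + S);
          c = 1 + complex_of_real ((1 - eps) / eps) * (det (R + S) / det S)
                   * exp (- qform Om xi)
      in (1 / c) *s ((R ** matrix_inv (R + S)) *v xi))"

definition se_err :: "real \<Rightarrow> complex ^ 'n ^ 'n \<Rightarrow> complex ^ 'n ^ 'n
    \<Rightarrow> complex ^ 'n ^ 'n" where
  "se_err eps R S =
     integral\<^sup>L (measure_pmf (bernoulli_pmf eps) \<Otimes>\<^sub>M (cgauss R \<Otimes>\<^sub>M cgauss S))
       (\<lambda>(a, h, v). let x = (if a then h else 0)
                     in outer (mmse_g eps R S (x + v) - x))"

primrec se_Sigma :: "real \<Rightarrow> nat \<Rightarrow> nat \<Rightarrow> (nat \<Rightarrow> real)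
    \<Rightarrow> (nat \<Rightarrow> complex ^ 'n ^ 'n) \<Rightarrow> nat \<Rightarrow> complex ^ 'n ^ 'n" where
  "se_Sigma sig2 L N eps R 0 =
     sig2 *\<^sub>R mat 1 + (1 / real L) *\<^sub>R (\<Sum>n\<in>{1..N}. R n)"
| "se_Sigma sig2 L N eps R (Suc t) =
     sig2 *\<^sub>R mat 1 + (1 / real L) *\<^sub>R
       (\<Sum>n\<in>{1..N}. se_err (eps n) (R n) (se_Sigma sig2 L N eps R t))"

end

theory Submission
  imports Defs
begin

text \<open>
  Let \<open>D\<close> be the diagonal matrix that flips the signs of one block. A matrix is block-diagonal
  iff it commutes with all these \<open>D\<close>, so it suffices that the error covariance is invariant
  under conjugation by \<open>D\<close>. The denoiser commutes with \<open>D\<close> because \<open>R\<close> and \<open>S\<close> do, and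
  \<open>CN(0, C)\<close> is invariant under \<open>D\<close> whenever \<open>D\<close> commutes with \<open>C = A A\<^sup>H\<close>: one has
  \<open>D A = A T\<close>, where \<open>T\<close> is the orthogonal reflection that negates the range of
  \<open>A\<^sup>H (1 - D)\<close>, and the standard Gaussian is invariant under every orthogonal map. Positive
  semidefiniteness is carried along the recursion, since it provides the factorization of \<open>C\<close> and
  the invertibility of the matrices in the denoiser. No integrability of the error is needed:
  the Bochner integral of a non-integrable function is \<open>0\<close>, which is block-diagonal and positive
  semidefinite.
\<close>

section \<open>Invariance of Lebesgue and Gaussian measure\<close>

text \<open>
  Both sides equal the double integral of the indicator of \<open>x \<in> A \<and> x + y \<in> B\<close>, evaluated in
  the two orders of integration.
\<close>
lemma emeasure_mult_lborel_translation_invariant: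
  fixes M :: "'a::euclidean_space measure"
  assumes "sigma_finite_measure M" and sets_M [measurable_cong]: "sets M = sets borel"
    and inv: "\<And>c. distr M borel ((+) c) = M"
    and [measurable]: "A \<in> sets borel" "B \<in> sets borel"
  shows "emeasure M A * emeasure lborel B = emeasure M B * emeasure lborel A"
proof -
  interpret sigma_finite_measure M by fact
  interpret pair_sigma_finite M lborel ..
  have shift: "(\<integral>\<^sup>+x. f (c + x) \<partial>M) = (\<integral>\<^sup>+x. f x \<partial>M)"
    if [measurable]: "f \<in> borel_measurable borel" for f :: "'a \<Rightarrow> ennreal" and c
    by (subst (2) inv[symmetric, of c]) (simp add: nn_integral_distr)
  have shift_lborel: "(\<integral>\<^sup>+x. f (c + x) \<partial>lborel) = (\<integral>\<^sup>+x. f x \<partial>lborel)"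
    if [measurable]: "f \<in> borel_measurable borel" for f :: "'a \<Rightarrow> ennreal" and c
    by (subst (2) lborel_distr_plus[symmetric, of c]) (simp add: nn_integral_distr)
  have refl_lborel: "(\<integral>\<^sup>+x. f (c - x) \<partial>lborel) = (\<integral>\<^sup>+x. f x \<partial>lborel)"
    if [measurable]: "f \<in> borel_measurable borel" for f :: "'a \<Rightarrow> ennreal" and c
    by (subst (2) lborel_affine[of "-1" c]) (simp_all add: nn_integral_distr density_1)
  have "emeasure M A * emeasure lborel B = (\<integral>\<^sup>+x. \<integral>\<^sup>+y. indicator A x * indicator B y \<partial>lborel \<partial>M)"
    by (simp add: nn_integral_cmult nn_integral_multc sets_M)
  also have "\<dots> = (\<integral>\<^sup>+x. \<integral>\<^sup>+y. indicator A x * indicator B (x + y) \<partial>lborel \<partial>M)"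
    by (simp add: nn_integral_cmult shift_lborel)
  also have "\<dots> = (\<integral>\<^sup>+y. \<integral>\<^sup>+x. indicator A x * indicator B (x + y) \<partial>M \<partial>lborel)"
    by (rule Fubini'[symmetric]) simp
  also have "\<dots> = (\<integral>\<^sup>+y. \<integral>\<^sup>+x. indicator A (- y + x) * indicator B (- y + x + y) \<partial>M \<partial>lborel)"
    by (subst shift[where f="\<lambda>x. indicator A x * indicator B (x + _)"]) simp_all
  also have "\<dots> = (\<integral>\<^sup>+y. \<integral>\<^sup>+x. indicator A (x - y) * indicator B x \<partial>M \<partial>lborel)"
    by simp
  also have "\<dots> = (\<integral>\<^sup>+x. \<integral>\<^sup>+y. indicator A (x - y) * indicator B x \<partial>lborel \<partial>M)"
    by (rule Fubini') simp
  also have "\<dots> = emeasure M B * emeasure lborel A"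
    by (simp add: nn_integral_cmult nn_integral_multc sets_M refl_lborel mult.commute)
  finally show ?thesis .
qed

lemma linear_borel_measurable:
  fixes f :: "'a::euclidean_space \<Rightarrow> 'b::real_normed_vector"
  assumes "linear f"
  shows "f \<in> borel_measurable borel"
  using assms by (intro borel_measurable_continuous_onI linear_continuous_on)
    (simp add: linear_conv_bounded_linear)

text \<open>The image measure is again translation invariant, so by the preceding lemma it is
  proportional to Lebesgue measure. The factor is 1 because \<open>T\<close> preserves the unit
  ball, whose measure is positive and finite.\<close>

lemma distr_lborel_orthogonal_transformation:
  fixes T :: "'a::euclidean_space \<Rightarrow> 'a"
  assumes T: "orthogonal_transformation T"
  shows "distr lborel borel T = lborel"
proof -
  have lin: "linear T" using T by (rule orthogonal_transformation_linear)
  have [measurable]: "T \<in> borel_measurable borel"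
    by (rule linear_borel_measurable[OF lin])
  obtain S where S: "orthogonal_transformation S" and TS: "\<And>x. T (S x) = x" "\<And>x. S (T x) = x"
    using orthogonal_transformation_inv[OF T] orthogonal_transformation_bij[OF T]
    by (metis bij_inv_eq_iff)
  have linS: "linear S" using S by (rule orthogonal_transformation_linear)
  have [measurable]: "S \<in> borel_measurable borel"
    by (rule linear_borel_measurable[OF linS])
  let ?M = "distr lborel borel T"
  \<comment> \<open>Sigma-finiteness is pulled back along \<open>S\<close>: a measure whose
    push-forward is sigma-finite is itself sigma-finite.\<close>
  have "distr ?M borel S = lborel"
    by (subst distr_distr) (simp_all add: o_def TS distr_id2)
  then have sf: "sigma_finite_measure ?M"
    using sigma_finite_measure_distr[of ?M borel S] by (simp add: sigma_finite_lborel)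
  have inv: "distr ?M borel ((+) c) = ?M" for c
  proof -
    \<comment> \<open>A shift by \<open>c\<close> after \<open>T\<close> is a shift by
      \<open>S c\<close> before \<open>T\<close>, which Lebesgue measure absorbs.\<close>
    have "distr ?M borel ((+) c) = distr lborel borel (\<lambda>x. T (S c + x))"
      by (subst distr_distr) (simp_all add: o_def linear_add[OF lin] TS)
    also have "\<dots> = distr (distr lborel borel ((+) (S c))) borel T"
      by (subst distr_distr) (simp_all add: o_def)
    finally show ?thesis by (simp add: lborel_distr_plus)
  qed
  have ball: "emeasure ?M (ball 0 1) = emeasure lborel (ball (0::'a) 1)"
  proof -
    have "T -` ball 0 1 = ball 0 1"
      using orthogonal_transformation_norm[OF T] by (auto simp: dist_norm)
    then show ?thesis by (simp add: emeasure_distr)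
  qed
  show ?thesis
  proof (rule measure_eqI)
    fix A assume "A \<in> sets ?M"
    then have A: "A \<in> sets borel" by simp
    have "emeasure ?M A * emeasure lborel (ball (0::'a) 1) = emeasure lborel A * emeasure lborel (ball (0::'a) 1)"
      using emeasure_mult_lborel_translation_invariant[OF sf _ inv A, of "ball 0 1"]
      by (simp add: ball mult.commute)
    moreover have "emeasure lborel (ball (0::'a) 1) \<noteq> 0" "emeasure lborel (ball (0::'a) 1) \<noteq> \<infinity>"
      using emeasure_lborel_ball_finite[of "0::'a" 1]
      unit_ball_vol_pos[of "real DIM('a)"]
      by (auto simp: emeasure_ball less_le)
    ultimately show "emeasure ?M A = emeasure lborel A"
      by (metis infinity_ennreal_def mult.commute ennreal_mult_cancel_left)
  qed simp
qed

section \<open>The standard complex Gaussian: finiteness and orthogonal invariance\<close>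

lemma std_cgauss_density_norm:
  fixes z :: "complex ^ 'n::finite"
  shows "(\<Prod>i\<in>UNIV. exp (- (cmod (z $ i))\<^sup>2) / pi) = exp (- (norm z)\<^sup>2) / pi ^ CARD('n)"
  by (simp add: prod_dividef exp_sum[symmetric] sum_negf norm_vec_def L2_set_def sum_nonneg)

lemma norm_sq_Basis:
  fixes z :: "'a::euclidean_space"
  shows "(norm z)\<^sup>2 = (\<Sum>b\<in>Basis. (z \<bullet> b)\<^sup>2)"
  unfolding power2_norm_eq_inner by (subst euclidean_inner) (simp add: power2_eq_square)

text \<open>Makes the measures \<open>cgauss C\<close> finite, so that their products can be handled
  as sigma-finite. The total mass factorizes over the real coordinates in \<open>Basis\<close> into
  one-dimensional Gaussian integrals.\<close>

lemma finite_measure_std_cgauss: "finite_measure (std_cgauss :: (complex ^ 'n::finite) measure)"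
proof
  let ?B = "Basis :: (complex ^ 'n) set"
  have gauss: "(\<integral>\<^sup>+x. ennreal (exp (- x\<^sup>2)) \<partial>lborel) < \<infinity>"
  proof -
    \<comment> \<open>The centered normal density of variance 1/2 is
      \<open>exp (- x\<^sup>2) / sqrt pi\<close>.\<close>
    have "integrable lborel (\<lambda>x. sqrt pi * normal_density 0 (sqrt (1/2)) x)"
      by (intro integrable_mult_right integrable_normal_density) simp
    then have "integrable lborel (\<lambda>x::real. exp (- x\<^sup>2))"
      by (simp add: normal_density_def)
    then show ?thesis
      by (simp add: nn_integral_eq_integral)
  qed
  have "emeasure (std_cgauss :: (complex ^ 'n) measure) (space std_cgauss)
      = (\<integral>\<^sup>+z. ennreal (1 / pi ^ CARD('n)) * (\<Prod>b\<in>?B. ennreal (exp (- (z \<bullet> b)\<^sup>2))) \<partial>(lborel :: (complex ^ 'n) measure))"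
    unfolding std_cgauss_def std_cgauss_density_norm
    by (subst emeasure_density, simp, simp)
      (auto intro!: nn_integral_cong simp: prod_ennreal exp_sum[symmetric] sum_negf
        ennreal_mult[symmetric] norm_sq_Basis)
  also have "\<dots> = ennreal (1 / pi ^ CARD('n)) * (\<Prod>b\<in>?B. (\<integral>\<^sup>+x. ennreal (exp (- x\<^sup>2)) \<partial>lborel))"
    by (subst nn_integral_cmult, measurable)
      (subst nn_integral_lborel_prod[where f = "\<lambda>_ x. ennreal (exp (- x\<^sup>2))"], simp_all)
  also have "\<dots> < \<infinity>"
    using gauss by (simp add: ennreal_mult_less_top power_less_top_ennreal)
  finally show "emeasure (std_cgauss :: (complex ^ 'n) measure) (space std_cgauss) \<noteq> \<infinity>"
    by simp
qed

text \<open>The density depends on the norm alone, and \<open>T\<close> preserves both the norm and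
  Lebesgue measure.\<close>

lemma distr_std_cgauss_orthogonal_transformation:
  fixes T :: "complex ^ 'n::finite \<Rightarrow> complex ^ 'n"
  assumes T: "orthogonal_transformation T"
  shows "distr std_cgauss borel T = std_cgauss"
proof -
  have [measurable]: "T \<in> borel_measurable borel"
    by (rule linear_borel_measurable[OF orthogonal_transformation_linear[OF T]])
  let ?f = "\<lambda>z::complex ^ 'n. ennreal (exp (- (norm z)\<^sup>2) / pi ^ CARD('n))"
  have "density (distr lborel borel T) ?f = distr (density lborel (\<lambda>z. ?f (T z))) borel T"
    by (rule density_distr) simp_all
  then show ?thesis
    by (simp add: std_cgauss_def std_cgauss_density_norm orthogonal_transformation_norm[OF T]
        distr_lborel_orthogonal_transformation[OF T])
qed

text \<open>The orthogonal decomposition yields a value for each \<open>z\<close> separately.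
  Linearity then follows from uniqueness: two candidates differ by a vector of \<open>W\<close>
  orthogonal to \<open>W\<close>.\<close>

lemma orthogonal_projection_exists:
  fixes W :: "'a::euclidean_space set"
  assumes W: "subspace W"
  obtains P where "linear P" "\<And>z. P z \<in> W" "\<And>z w. w \<in> W \<Longrightarrow> (z - P z) \<bullet> w = 0"
proof -
  have "\<exists>p. p \<in> W \<and> (\<forall>w\<in>W. (z - p) \<bullet> w = 0)" for z
  proof -
    obtain y u where "y \<in> span W" "\<And>w. w \<in> span W \<Longrightarrow> orthogonal u w" "z = y + u"
      using orthogonal_subspace_decomp_exists[of W z] by blast
    then show ?thesis
      by (intro exI[of _ y]) (auto simp: orthogonal_def span_eq_iff[THEN iffD2, OF W])
  qed
  then obtain P where P: "P z \<in> W" "w \<in> W \<Longrightarrow> (z - P z) \<bullet> w = 0" for z w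
    by metis
  have uniq: "p = P z" if "p \<in> W" "\<And>w. w \<in> W \<Longrightarrow> (z - p) \<bullet> w = 0" for z p
  proof -
    have "p - P z \<in> W" using W that(1) P(1) by (rule subspace_diff)
    then have "(z - P z) \<bullet> (p - P z) = 0" "(z - p) \<bullet> (p - P z) = 0"
      using P(2) that(2) by blast+
    then have "(p - P z) \<bullet> (p - P z) = 0" by (simp add: inner_diff_left)
    then show ?thesis by simp
  qed
  have "linear P"
  proof (rule linearI)
    show "P (x + y) = P x + P y" for x y
    proof (rule uniq[symmetric])
      show "P x + P y \<in> W" using W P(1) P(1) by (rule subspace_add)
      show "(x + y - (P x + P y)) \<bullet> w = 0" if "w \<in> W" for w
        using P(2)[OF that, of x] P(2)[OF that, of y] by (simp add: inner_diff_left inner_add_left)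
    qed
    show "P (r *\<^sub>R x) = r *\<^sub>R P x" for r x
    proof (rule uniq[symmetric])
      show "r *\<^sub>R P x \<in> W" using W P(1) by (rule subspace_scale)
      show "(r *\<^sub>R x - r *\<^sub>R P x) \<bullet> w = 0" if "w \<in> W" for w
        using P(2)[OF that, of x] by (simp add: inner_diff_left)
    qed
  qed
  with P that show thesis by blast
qed

text \<open>The squared norm of \<open>z - 2 *\<^sub>R P z\<close> differs from that of
  \<open>z\<close> by four times \<open>(z - P z) \<bullet> P z\<close>.\<close>

lemma orthogonal_transformation_reflection:
  assumes P: "linear P" "\<And>z. (z - P z) \<bullet> P z = 0"
  shows "orthogonal_transformation (\<lambda>z. z - 2 *\<^sub>R P z)"
  unfolding orthogonal_transformation
proof (intro conjI allI)
  show "linear (\<lambda>z. z - 2 *\<^sub>R P z)"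
    using P(1) by (intro linear_compose_sub linear_ident linear_compose_scale_right)
  show "norm (z - 2 *\<^sub>R P z) = norm z" for z
    using P(2)[of z] by (simp add: norm_eq_sqrt_inner algebra_simps inner_commute)
qed

section \<open>Invariance of complex Gaussians under commuting involutions\<close>

text \<open>The Hermitian inner product, conjugate-linear on the left. Its real part is the
  Euclidean \<open>inner\<close>, which links complex adjoints to real orthogonal
  projections.\<close>

definition cinner :: "complex ^ 'n::finite \<Rightarrow> complex ^ 'n \<Rightarrow> complex" where
  "cinner x y = (\<Sum>i\<in>UNIV. cnj (x $ i) * y $ i)"

lemma Re_cinner: "Re (cinner x y) = x \<bullet> y"
  by (simp add: cinner_def inner_vec_def inner_complex_def)

lemma qform_eq_cinner: "qform A x = cinner x (A *v x)"
  by (simp add: qform_def cinner_def)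

lemma cinner_cadj:
  fixes A :: "complex ^ 'n::finite ^ 'n"
  shows "cinner (cadj A *v x) z = cinner x (A *v z)"
proof -
  have "cinner (cadj A *v x) z = (\<Sum>i\<in>UNIV. \<Sum>j\<in>UNIV. cnj (x $ j) * (A $ j $ i * z $ i))"
    by (simp add: cinner_def matrix_vector_mult_def cadj_def sum_distrib_left mult_ac)
  also have "\<dots> = (\<Sum>j\<in>UNIV. \<Sum>i\<in>UNIV. cnj (x $ j) * (A $ j $ i * z $ i))"
    by (rule sum.swap)
  also have "\<dots> = cinner x (A *v z)"
    by (simp add: cinner_def matrix_vector_mult_def sum_distrib_left)
  finally show ?thesis .
qed

lemma cadj_mult_vec_inner:
  fixes A :: "complex ^ 'n::finite ^ 'n"
  shows "(cadj A *v x) \<bullet> z = x \<bullet> (A *v z)"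
  by (simp add: Re_cinner[symmetric] cinner_cadj)

lemma linear_matrix_vector_mult_complex:
  fixes A :: "complex ^ 'n::finite ^ 'n"
  shows "linear ((*v) A)"
  by (rule linearI)
    (simp_all add: matrix_vector_right_distrib vec_eq_iff matrix_vector_mult_def scaleR_sum_right
      sum.distrib distrib_left)

lemma measurable_matrix_vector_mult_complex [measurable]:
  fixes A :: "complex ^ 'n::finite ^ 'n"
  shows "(*v) A \<in> borel_measurable borel"
  by (rule linear_borel_measurable[OF linear_matrix_vector_mult_complex])

text \<open>Since \<open>A\<close> may be singular, conjugating \<open>D\<close> by \<open>A\<close>
  is no way to obtain \<open>T\<close>. Instead \<open>A\<close> sends the range of
  \<open>?w\<close> into the (-1)-eigenspace of \<open>D\<close> and its orthogonal complement into
  the (+1)-eigenspace, so reflecting in that range does the job.\<close>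

lemma involution_intertwines_reflection:
  fixes A D :: "complex ^ 'n::finite ^ 'n"
  assumes D: "D ** D = mat 1" "cadj D = D"
    and comm: "D ** (A ** cadj A) = (A ** cadj A) ** D"
  obtains T where "orthogonal_transformation T" "\<And>z. D *v (A *v z) = A *v T z"
proof -
  note lin = linear_matrix_vector_mult_complex
  let ?w = "\<lambda>x. cadj A *v (x - D *v x)"
  have "linear ?w"
    using linear_compose[OF linear_compose_sub[OF linear_ident lin[of D]] lin[of "cadj A"]]
    by (simp add: o_def)
  then have "subspace (range ?w)"
    by (rule linear_subspace_image) simp
  then obtain P where P: "linear P" "\<And>z. P z \<in> range ?w"
      "\<And>z w. w \<in> range ?w \<Longrightarrow> (z - P z) \<bullet> w = 0"
    by (rule orthogonal_projection_exists) blast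
  have neg: "D *v (A *v P z) = - (A *v P z)" for z
  proof -
    obtain x where x: "P z = ?w x" using P(2)[of z] by blast
    define y where "y = (A ** cadj A) *v x"
    \<comment> \<open>Here the commutation of \<open>D\<close> with \<open>A ** cadj A\<close>
      enters; \<open>D\<close> negates \<open>y - D *v y\<close> because it is an
      involution.\<close>
    have "A *v P z = y - D *v y"
      unfolding x y_def
      using comm by (simp add: matrix_vector_mul_assoc linear_diff[OF lin] matrix_mul_assoc)
    then show ?thesis
      by (simp add: linear_diff[OF lin] matrix_vector_mul_assoc D(1))
  qed
  have pos: "D *v (A *v (z - P z)) = A *v (z - P z)" for z
  proof -
    let ?u = "A *v (z - P z)"
    \<comment> \<open>Self-adjointness of \<open>D\<close> moves everything onto \<open>y\<close>,
      turning the pairing into that of \<open>?w y\<close> with \<open>z - P z\<close>. Taking the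
      vector itself for \<open>y\<close> then shows that it vanishes.\<close>
    have "(?u - D *v ?u) \<bullet> y = 0" for y
    proof -
      have "(D *v ?u) \<bullet> y = ?u \<bullet> (D *v y)"
        using cadj_mult_vec_inner[of D ?u y] by (simp add: D(2))
      then have "(?u - D *v ?u) \<bullet> y = (y - D *v y) \<bullet> ?u"
        by (simp add: inner_diff_left inner_diff_right inner_commute)
      also have "\<dots> = ?w y \<bullet> (z - P z)"
        by (simp add: cadj_mult_vec_inner)
      also have "\<dots> = 0"
        using P(3)[of "?w y" z] by (simp add: inner_commute)
      finally show ?thesis .
    qed
    from this[of "?u - D *v ?u"] show ?thesis by simp
  qed
  show thesis
  proof
    show "orthogonal_transformation (\<lambda>z. z - 2 *\<^sub>R P z)"
      using P by (intro orthogonal_transformation_reflection) auto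
    show "D *v (A *v z) = A *v (z - 2 *\<^sub>R P z)" for z
    proof -
      have "D *v (A *v z) = A *v z - A *v P z - A *v P z"
        using pos[of z] neg[of z] by (simp add: linear_diff[OF lin] algebra_simps)
      then show ?thesis
        unfolding linear_diff[OF lin] linear_scale[OF lin] unfolding scaleR_2 by simp
    qed
  qed
qed

section \<open>Complex Gaussians with general covariance\<close>

lemma sets_std_cgauss [measurable_cong, simp]: "sets std_cgauss = sets borel"
  by (simp add: std_cgauss_def)

lemma sets_cgauss [measurable_cong, simp]: "sets (cgauss C) = sets borel"
  by (simp add: cgauss_def)

text \<open>Passing \<open>D\<close> through the factor \<open>A\<close> turns it into an orthogonal
  map acting on the standard Gaussian, where it disappears.\<close>

lemma distr_cgauss_involution:
  fixes C D :: "complex ^ 'n::finite ^ 'n"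
  assumes C: "\<exists>A. A ** cadj A = C"
    and D: "D ** D = mat 1" "cadj D = D" "D ** C = C ** D"
  shows "distr (cgauss C) borel ((*v) D) = cgauss C"
proof -
  define A where "A = (SOME A. A ** cadj A = C)"
  \<comment> \<open>Existence of some factor guarantees that the choice made in
    \<open>cgauss\<close> is a genuine one.\<close>
  have A: "A ** cadj A = C"
    unfolding A_def by (rule someI_ex) (rule C)
  obtain T where T: "orthogonal_transformation T" and DT: "\<And>z. D *v (A *v z) = A *v T z"
    using involution_intertwines_reflection[of D A] D A by metis
  have [measurable]: "T \<in> borel_measurable borel"
    by (rule linear_borel_measurable[OF orthogonal_transformation_linear[OF T]])
  have cg: "cgauss C = distr std_cgauss borel ((*v) A)"
    by (simp add: cgauss_def A_def)
  have "distr (cgauss C) borel ((*v) D) = distr std_cgauss borel (\<lambda>z. A *v T z)"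
    unfolding cg by (subst distr_distr) (simp_all add: o_def DT)
  also have "\<dots> = distr (distr std_cgauss borel T) borel ((*v) A)"
    by (subst distr_distr) (simp_all add: o_def)
  finally show ?thesis
    by (simp add: cg distr_std_cgauss_orthogonal_transformation[OF T])
qed

lemma finite_measure_cgauss: "finite_measure (cgauss C)"
  unfolding cgauss_def
  by (rule finite_measure.finite_measure_distr[OF finite_measure_std_cgauss]) simp

section \<open>Equivariance of the MMSE denoiser\<close>

lemma matrix_add_rdistrib:
  fixes A :: "'a::semiring_1 ^ 'n::finite ^ 'm"
  shows "(A + B) ** C = A ** C + B ** C"
  by (simp add: vec_eq_iff matrix_matrix_mult_def sum.distrib distrib_right)

lemma matrix_diff_ldistrib:
  fixes A :: "'a::ring_1 ^ 'n::finite ^ 'm"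
  shows "A ** (B - C) = A ** B - A ** C"
  by (simp add: vec_eq_iff matrix_matrix_mult_def sum_subtractf right_diff_distrib)

lemma matrix_diff_rdistrib:
  fixes A :: "'a::ring_1 ^ 'n::finite ^ 'm"
  shows "(A - B) ** C = A ** C - B ** C"
  by (simp add: vec_eq_iff matrix_matrix_mult_def sum_subtractf left_diff_distrib)

lemma matrix_inv_commute:
  fixes S D :: "'a::field ^ 'n::finite ^ 'n"
  assumes "invertible S" "D ** S = S ** D"
  shows "D ** matrix_inv S = matrix_inv S ** D"
proof -
  have inv: "S ** matrix_inv S = mat 1" "matrix_inv S ** S = mat 1"
    using assms(1) unfolding matrix_inv_def invertible_def by (metis (mono_tags, lifting) someI_ex)+
  have "D ** matrix_inv S = (matrix_inv S ** S) ** D ** matrix_inv S"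
    by (simp add: inv)
  also have "\<dots> = matrix_inv S ** D ** (S ** matrix_inv S)"
    by (metis assms(2) matrix_mul_assoc)
  finally show ?thesis by (simp add: inv)
qed

lemma qform_involution:
  fixes A D :: "complex ^ 'n::finite ^ 'n"
  assumes "D ** D = mat 1" "cadj D = D" "D ** A = A ** D"
  shows "qform A (D *v x) = qform A x"
proof -
  have "qform A (D *v x) = cinner (cadj D *v x) (A *v (D *v x))"
    by (simp add: qform_eq_cinner assms(2))
  also have "\<dots> = cinner x ((D ** (A ** D)) *v x)"
    by (simp add: cinner_cadj matrix_vector_mul_assoc)
  also have "D ** (A ** D) = A"
    by (metis assms(1,3) matrix_mul_assoc matrix_mul_rid)
  finally show ?thesis by (simp add: qform_eq_cinner)
qed

text \<open>Commuting with \<open>R\<close> and \<open>S\<close>, \<open>D\<close> also commutes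
  with the inverses. Hence the quadratic form in the exponent, and with it the scalar weight, is
  unchanged, while the linear factor lets \<open>D\<close> through.\<close>

lemma mmse_g_involution:
  fixes R S D :: "complex ^ 'n::finite ^ 'n"
  assumes D: "D ** D = mat 1" "cadj D = D"
    and comm: "D ** R = R ** D" "D ** S = S ** D"
    and inv: "invertible S" "invertible (R + S)"
  shows "mmse_g eps R S (D *v xi) = D *v mmse_g eps R S xi"
proof -
  have RS: "D ** (R + S) = (R + S) ** D"
    by (simp add: comm matrix_add_ldistrib matrix_add_rdistrib)
  have iS: "D ** matrix_inv S = matrix_inv S ** D"
    and iRS: "D ** matrix_inv (R + S) = matrix_inv (R + S) ** D"
    using matrix_inv_commute inv comm RS by blast+
  have "D ** (matrix_inv S - matrix_inv (R + S)) = (matrix_inv S - matrix_inv (R + S)) ** D"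
    using iS iRS by (simp add: matrix_diff_ldistrib matrix_diff_rdistrib)
  then have q: "qform (matrix_inv S - matrix_inv (R + S)) (D *v xi)
      = qform (matrix_inv S - matrix_inv (R + S)) xi"
    by (rule qform_involution[OF D])
  have W: "(R ** matrix_inv (R + S)) ** D = D ** (R ** matrix_inv (R + S))"
    by (metis comm(1) iRS matrix_mul_assoc)
  show ?thesis
    unfolding mmse_g_def Let_def q
    by (simp add: matrix_vector_mul_assoc W vector_scalar_commute)
qed

section \<open>Positive semidefinite matrices\<close>

lemma cinner_add_left: "cinner (x + y) z = cinner x z + cinner y z"
  by (simp add: cinner_def sum.distrib distrib_right)

lemma cinner_add_right: "cinner x (y + z) = cinner x y + cinner x z"
  by (simp add: cinner_def sum.distrib distrib_left)

lemma cinner_scale_left: "cinner (c *s x) y = cnj c * cinner x y"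
  by (simp add: cinner_def sum_distrib_left mult_ac)

lemma cinner_scale_right: "cinner x (c *s y) = c * cinner x y"
  by (simp add: cinner_def sum_distrib_left mult_ac)

lemma cnj_cinner: "cnj (cinner x y) = cinner y x"
  by (simp add: cinner_def mult.commute)

lemma cinner_axis_left: "cinner (axis i 1) y = y $ i"
  by (simp add: cinner_def axis_def if_distrib if_distribR cong: if_cong)

lemma matrix_vector_mult_axis:
  fixes A :: "complex ^ 'n::finite ^ 'm"
  shows "A *v axis j 1 = column j A"
  by (simp add: vec_eq_iff matrix_vector_mult_def column_def axis_def if_distrib if_distribR cong: if_cong)

lemma qform_add: "qform (A + B) x = qform A x + qform B x"
  by (simp add: qform_eq_cinner matrix_vector_mult_add_rdistrib cinner_add_right)

lemma qform_scaleR: "qform (r *\<^sub>R A) x = r *\<^sub>R qform A x"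
  by (simp add: qform_def matrix_vector_mult_def scaleR_sum_right[symmetric])

lemma qform_mat_1: "qform (mat 1) x = complex_of_real ((norm x)\<^sup>2)"
proof -
  have "cinner x x = complex_of_real (Re (cinner x x))"
    using cnj_cinner[of x x] by (metis Reals_cnj_iff of_real_Re)
  then show ?thesis
    by (simp add: qform_eq_cinner Re_cinner power2_norm_eq_inner)
qed

lemma cnj_mult_self: "cnj z * z = complex_of_real ((cmod z)\<^sup>2)"
  by (metis complex_norm_square mult.commute of_real_power)

lemma qform_outer: "qform (outer u) x = complex_of_real ((cmod (cinner x u))\<^sup>2)"
proof -
  have "outer u *v x = cinner u x *s u"
    by (simp add: vec_eq_iff outer_def matrix_vector_mult_def cinner_def sum_distrib_left mult_ac)
  then have "qform (outer u) x = cnj (cinner x u) * cinner x u"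
    by (simp add: qform_eq_cinner cinner_scale_right cnj_cinner)
  then show ?thesis
    by (simp only: cnj_mult_self)
qed

lemma psd_add: "psd A \<Longrightarrow> psd B \<Longrightarrow> psd (A + B)"
  by (simp add: psd_def qform_add)

lemma psd_scaleR: "0 \<le> r \<Longrightarrow> psd A \<Longrightarrow> psd (r *\<^sub>R A)"
  by (auto simp: psd_def qform_scaleR complex_is_Real_iff)

lemma psd_0: "psd 0"
  by (simp add: psd_def qform_def)

lemma psd_sum: "(\<And>i. i \<in> I \<Longrightarrow> psd (A i)) \<Longrightarrow> psd (\<Sum>i\<in>I. A i)"
  by (induction I rule: infinite_finite_induct) (auto simp: psd_0 psd_add)

lemma psd_outer: "psd (outer u)"
  by (simp add: psd_def qform_outer)

text \<open>Polarization: realness of the form at \<open>x + y\<close> relates the imaginary parts,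
  and at \<open>x + \<i> *s y\<close> the real parts. So \<open>psd\<close> already entails
  Hermitian symmetry.\<close>

lemma psd_cinner_swap:
  assumes "psd C"
  shows "cinner y (C *v x) = cnj (cinner x (C *v y))"
proof -
  have real: "Im (qform C z) = 0" for z
    using assms by (auto simp: psd_def complex_is_Real_iff)
  have "Im (cinner x (C *v y) + cinner y (C *v x)) = 0"
    using real[of "x + y"] real[of x] real[of y]
    by (simp add: qform_eq_cinner cinner_add_left cinner_add_right matrix_vector_right_distrib)
  moreover have "Re (cinner x (C *v y)) - Re (cinner y (C *v x)) = 0"
    using real[of "x + \<i> *s y"] real[of x] real[of y]
    by (simp add: qform_eq_cinner cinner_add_left cinner_add_right matrix_vector_right_distrib
        vector_scalar_commute cinner_scale_left cinner_scale_right)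
  ultimately show ?thesis
    by (simp add: complex_eq_iff)
qed

text \<open>Moving along one coordinate axis is the perturbation used below, both for zero diagonal
  entries and for the Schur complement.\<close>

lemma qform_add_axis:
  assumes "psd C"
  shows "qform C (x + a *s axis s 1)
    = qform C x + complex_of_real (2 * Re (cnj a * (C *v x) $ s)) + cnj a * a * C $ s $ s"
proof -
  have ss: "cinner (axis s 1) (C *v axis s 1) = C $ s $ s"
    by (simp add: cinner_axis_left matrix_vector_mult_axis column_def)
  have "cinner x (C *v axis s 1) = cnj ((C *v x) $ s)"
    using psd_cinner_swap[OF assms, of x "axis s 1"] by (simp add: cinner_axis_left)
  then have "qform C (x + a *s axis s 1)
    = qform C x + (a * cnj ((C *v x) $ s) + cnj a * (C *v x) $ s) + cnj a * a * C $ s $ s"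
    by (simp add: qform_eq_cinner cinner_add_left cinner_add_right matrix_vector_right_distrib
        vector_scalar_commute cinner_scale_left cinner_scale_right cinner_axis_left[of s "C *v x"] ss algebra_simps)
  moreover have "a * cnj ((C *v x) $ s) + cnj a * (C *v x) $ s = complex_of_real (2 * Re (cnj a * (C *v x) $ s))"
    by (simp add: complex_eq_iff)
  ultimately show ?thesis by simp
qed

lemma psd_entries:
  assumes "psd C"
  shows psd_entry_swap: "C $ j $ i = cnj (C $ i $ j)"
    and psd_diag_real: "C $ i $ i = complex_of_real (Re (C $ i $ i))"
    and psd_diag_nonneg: "0 \<le> Re (C $ i $ i)"
proof -
  have e: "cinner (axis i 1) (C *v axis j 1) = C $ i $ j" for i j
    by (simp add: cinner_axis_left matrix_vector_mult_axis column_def)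
  show "C $ j $ i = cnj (C $ i $ j)" for i j
    using psd_cinner_swap[OF assms, of "axis j 1" "axis i 1"] by (simp add: e)
  have "qform C (axis i 1) = C $ i $ i" by (simp add: qform_eq_cinner e)
  then show "C $ i $ i = complex_of_real (Re (C $ i $ i))" "0 \<le> Re (C $ i $ i)"
    using assms by (auto simp: psd_def complex_is_Real_iff complex_eq_iff dest!: spec[of _ "axis i 1"])
qed

text \<open>Moving from \<open>axis j 1\<close> along axis \<open>s\<close> makes the form affine in
  \<open>t\<close> with slope \<open>- 2 * (cmod ?b)\<^sup>2\<close>; it can stay nonnegative for
  all \<open>t\<close> only if \<open>?b\<close> is zero.\<close>

lemma psd_diag_zero:
  assumes C: "psd C" and "C $ s $ s = 0"
  shows "C $ s $ j = 0"
proof -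
  let ?x = "axis j 1 :: complex ^ 'a" and ?b = "C $ s $ j"
  have b: "(C *v ?x) $ s = ?b"
    by (simp add: matrix_vector_mult_axis column_def)
  have "0 \<le> Re (qform C ?x) - 2 * t * (cmod ?b)\<^sup>2" for t
  proof -
    let ?a = "complex_of_real (- t) * ?b"
    have "cnj ?a * ?b = complex_of_real (- t) * (cnj ?b * ?b)"
      by simp
    also have "\<dots> = complex_of_real (- t * (cmod ?b)\<^sup>2)"
      by (simp only: cnj_mult_self of_real_mult)
    finally have "Re (cnj ?a * ?b) = - t * (cmod ?b)\<^sup>2"
      by (simp only: Re_complex_of_real)
    then have "Re (qform C (?x + ?a *s axis s 1)) = Re (qform C ?x) - 2 * t * (cmod ?b)\<^sup>2"
      unfolding qform_add_axis[OF C] b assms(2) by simp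
    then show ?thesis using C by (metis psd_def)
  qed
  \<comment> \<open>If \<open>?b\<close> were nonzero, this \<open>t\<close> would bring the lower
    bound's right-hand side to -1.\<close>
  from this[of "(Re (qform C ?x) + 1) / (2 * (cmod ?b)\<^sup>2)"] show ?thesis
    by (cases "?b = 0") (auto simp: field_simps)
qed

text \<open>One step of Cholesky elimination: \<open>outer u\<close> has the same row
  \<open>s\<close> as \<open>C\<close>.\<close>

lemma psd_schur_complement:
  assumes C: "psd C" and ss: "C $ s $ s \<noteq> 0"
  defines "u \<equiv> complex_of_real (1 / sqrt (Re (C $ s $ s))) *s column s C"
  shows "psd (C - outer u)" "(C - outer u) $ s $ j = 0"
proof -
  define d where "d = Re (C $ s $ s)"
  have d: "C $ s $ s = complex_of_real d" "d > 0"
    using psd_diag_real[OF C, of s] psd_diag_nonneg[OF C, of s] ss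
    unfolding d_def by (auto simp: complex_eq_iff)
  have sq: "complex_of_real (sqrt d) * complex_of_real (sqrt d) = complex_of_real d"
    using d(2) by (simp flip: of_real_mult)
  have u: "u = complex_of_real (1 / sqrt d) *s (C *v axis s 1)"
    by (simp add: u_def d_def matrix_vector_mult_axis)
  show "(C - outer u) $ s $ j = 0"
    using d psd_entry_swap[OF C, of s j]
    by (simp add: u_def d_def[symmetric] outer_def column_def sq)
  \<comment> \<open>The shift along axis \<open>s\<close> minimizes the form of \<open>C\<close>,
    and the minimum is the form of the complement; its nonnegativity is therefore inherited.\<close>
  have "qform (C - outer u) x = qform C (x + (- ((C *v x) $ s) / d) *s axis s 1)" for x
  proof -
    let ?b = "(C *v x) $ s"
    have "cinner x (C *v axis s 1) = cnj ?b"
      using psd_cinner_swap[OF C, of x "axis s 1"] by (simp add: cinner_axis_left)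
    then have "cinner x u = complex_of_real (1 / sqrt d) * cnj ?b"
      by (simp add: u cinner_scale_right)
    then have "(cmod (cinner x u))\<^sup>2 = (cmod ?b)\<^sup>2 / d"
      using d(2) by (simp add: norm_mult norm_divide power_divide power_mult_distrib)
    moreover have "qform (C - outer u) x = qform C x - qform (outer u) x"
      using qform_add[of "C - outer u" "outer u" x] by simp
    ultimately have 1: "qform (C - outer u) x = qform C x - complex_of_real ((cmod ?b)\<^sup>2 / d)"
      by (simp add: qform_outer)
    note bb = cnj_mult_self[of ?b]
    have "cnj (- ?b / d) * ?b = complex_of_real (- (cmod ?b)\<^sup>2 / d)"
      using bb by simp
    moreover have "cnj (- ?b / d) * (- ?b / d) * d = complex_of_real ((cmod ?b)\<^sup>2 / d)"
      using bb d(2) by (simp add: field_simps)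
    ultimately have "qform C (x + (- ?b / d) *s axis s 1)
        = qform C x + complex_of_real (2 * Re (complex_of_real (- (cmod ?b)\<^sup>2 / d)))
          + complex_of_real ((cmod ?b)\<^sup>2 / d)"
      using qform_add_axis[OF C, of x "- ?b / d" s] by (simp only: d(1))
    also have "\<dots> = qform C x - complex_of_real ((cmod ?b)\<^sup>2 / d)"
      by simp
    finally show ?thesis using 1 by simp
  qed
  then show "psd (C - outer u)"
    using C by (simp add: psd_def)
qed

text \<open>\<open>I\<close> holds the rows that may still be nonzero; each induction step clears
  one of them. With a zero diagonal entry the row already vanishes and \<open>outer 0\<close> is
  subtracted.\<close>

lemma psd_eq_sum_outer:
  fixes C :: "complex ^ 'n::finite ^ 'n"
  assumes "finite I" "psd C" "\<And>i j. i \<notin> I \<Longrightarrow> C $ i $ j = 0"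
  shows "\<exists>u. C = (\<Sum>l\<in>I. outer (u l))"
  using assms
proof (induction I arbitrary: C rule: finite_induct)
  case empty
  then show ?case by (simp add: vec_eq_iff)
next
  case (insert s I)
  obtain v where v: "psd (C - outer v)" "\<And>i j. i \<notin> I \<Longrightarrow> (C - outer v) $ i $ j = 0"
  proof (cases "C $ s $ s = 0")
    case True
    have "outer 0 = (0 :: complex ^ 'n ^ 'n)"
      by (simp add: outer_def vec_eq_iff)
    moreover have "C $ i $ j = 0" if "i \<notin> I" for i j
      using psd_diag_zero[OF insert.prems(1) True] insert.prems(2)[of i j] that by (cases "i = s") auto
    ultimately show thesis
      using that[of 0] insert.prems(1) by simp
  next
    case False
    let ?u = "complex_of_real (1 / sqrt (Re (C $ s $ s))) *s column s C"
    have "(C - outer ?u) $ i $ j = 0" if "i \<notin> I" for i j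
    proof (cases "i = s")
      case True
      show ?thesis
        unfolding True by (rule psd_schur_complement(2)[OF insert.prems(1) False])
    next
      case False
      \<comment> \<open>All columns are covered, since column \<open>s\<close> is what makes entry
        \<open>i\<close> of \<open>?u\<close> vanish.\<close>
      then have "C $ i $ j = 0" for j using insert.prems(2)[of i j] that by simp
      then show ?thesis by (simp add: outer_def column_def)
    qed
    with psd_schur_complement(1)[OF insert.prems(1) False] show thesis
      by (rule that)
  qed
  obtain u where u: "C - outer v = (\<Sum>l\<in>I. outer (u l))"
    using insert.IH[OF v] by blast
  have "C = (\<Sum>l\<in>insert s I. outer ((u(s := v)) l))"
  proof -
    have "(\<Sum>l\<in>I. outer ((u(s := v)) l)) = (\<Sum>l\<in>I. outer (u l))"
      using insert.hyps by (intro sum.cong) auto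
    then show ?thesis
      using insert.hyps u by (simp add: algebra_simps)
  qed
  then show ?case by blast
qed

lemma psd_factorization:
  fixes C :: "complex ^ 'n::finite ^ 'n"
  assumes "psd C"
  shows "\<exists>A. A ** cadj A = C"
proof -
  obtain u :: "'n \<Rightarrow> complex ^ 'n" where "C = (\<Sum>l\<in>UNIV. outer (u l))"
    using psd_eq_sum_outer[of UNIV C] assms by auto
  \<comment> \<open>The vectors \<open>u l\<close> become the columns of the factor.\<close>
  then have "(\<chi> i l. u l $ i) ** cadj (\<chi> i l. u l $ i) = C"
    by (simp add: vec_eq_iff matrix_matrix_mult_def cadj_def outer_def)
  then show ?thesis by blast
qed

text \<open>The form is bounded below by \<open>r * (norm x)\<^sup>2\<close>, so the kernel is
  trivial.\<close>

lemma invertible_scaled_mat_1_plus_psd: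
  fixes P :: "complex ^ 'n::finite ^ 'n"
  assumes "0 < r" "psd P"
  shows "invertible (r *\<^sub>R mat 1 + P)"
proof -
  have "x = 0" if "(r *\<^sub>R mat 1 + P) *v x = 0" for x
  proof -
    have "0 = Re (qform (r *\<^sub>R mat 1 + P) x)"
      using that by (simp add: qform_def)
    also have "\<dots> = r * (norm x)\<^sup>2 + Re (qform P x)"
      by (simp add: qform_add qform_scaleR qform_mat_1)
    finally have "r * (norm x)\<^sup>2 \<le> 0"
      using assms(2) by (simp add: psd_def) (smt (verit))
    then show ?thesis
      using assms(1) by (simp add: mult_le_0_iff)
  qed
  then show ?thesis
    by (simp add: invertible_left_inverse matrix_left_invertible_ker)
qed

section \<open>Positive semidefiniteness of integrals\<close>

lemma linear_qform: "linear (\<lambda>A. qform A x)"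
  by (rule linearI) (simp_all add: qform_add qform_scaleR)

text \<open>For fixed \<open>x\<close> the form is a bounded real-linear function of the matrix,
  hence commutes with the integral.\<close>

lemma psd_integral:
  fixes F :: "'a \<Rightarrow> complex ^ 'n::finite ^ 'n"
  assumes "\<And>w. psd (F w)"
  shows "psd (integral\<^sup>L M F)"
proof (cases "integrable M F")
  case False
  then show ?thesis by (simp add: not_integrable_integral_eq psd_0)
next
  case True
  show ?thesis
    unfolding psd_def complex_is_Real_iff
  proof
    fix x :: "complex ^ 'n"
    note bl = linear_conv_bounded_linear[THEN iffD1, OF linear_qform[of x]]
    have q: "qform (integral\<^sup>L M F) x = (\<integral>w. qform (F w) x \<partial>M)"
      using integral_bounded_linear[OF bl True] by simp
    have "integrable M (\<lambda>w. qform (F w) x)"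
      using integrable_bounded_linear[OF bl True] .
    then have "Re (\<integral>w. qform (F w) x \<partial>M) = (\<integral>w. Re (qform (F w) x) \<partial>M)"
      and "Im (\<integral>w. qform (F w) x \<partial>M) = (\<integral>w. Im (qform (F w) x) \<partial>M)"
      by (simp_all only: integral_Re integral_Im)
    moreover have "Im (qform (F w) x) = 0" "0 \<le> Re (qform (F w) x)" for w
      using assms[of w] by (auto simp: psd_def complex_is_Real_iff)
    ultimately show "Im (qform (integral\<^sup>L M F) x) = 0 \<and> 0 \<le> Re (qform (integral\<^sup>L M F) x)"
      unfolding q by simp
  qed
qed

lemma psd_se_err: "psd (se_err eps R S)"
  unfolding se_err_def by (intro psd_integral) (simp add: Let_def psd_outer split: prod.split)

section \<open>Block-diagonal matrices and the state evolution\<close>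

text \<open>The sign flip \<open>D\<close> for block \<open>k\<close>. Conjugating by it negates
  exactly the entries with one index inside block \<open>k\<close> and the other outside.\<close>

definition block_flip :: "'k \<Rightarrow> complex ^ ('k::finite \<times> 'm::finite) ^ ('k \<times> 'm)" where
  "block_flip k = (\<chi> p q. if p = q then if fst p = k then - 1 else 1 else 0)"

lemma block_flip_mult_vec:
  "(block_flip k *v x) $ p = (if fst p = k then - (x $ p) else x $ p)"
proof -
  have "(block_flip k *v x) $ p
      = (\<Sum>q\<in>UNIV. if q = p then if fst p = k then - (x $ q) else x $ q else 0)"
    unfolding block_flip_def matrix_vector_mult_def vec_lambda_beta by (intro sum.cong) auto
  then show ?thesis by simp
qed

lemma block_flip_mult:
  "(block_flip k ** A) $ p $ q = (if fst p = k then - (A $ p $ q) else A $ p $ q)"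
proof -
  have "(block_flip k ** A) $ p $ q
      = (\<Sum>r\<in>UNIV. if r = p then if fst p = k then - (A $ r $ q) else A $ r $ q else 0)"
    unfolding block_flip_def matrix_matrix_mult_def vec_lambda_beta by (intro sum.cong) auto
  then show ?thesis by simp
qed

lemma mult_block_flip:
  "(A ** block_flip k) $ p $ q = (if fst q = k then - (A $ p $ q) else A $ p $ q)"
proof -
  have "(A ** block_flip k) $ p $ q
      = (\<Sum>r\<in>UNIV. if r = q then if fst q = k then - (A $ p $ r) else A $ p $ r else 0)"
    unfolding block_flip_def matrix_matrix_mult_def vec_lambda_beta by (intro sum.cong) auto
  then show ?thesis by simp
qed

lemma block_flip_involution: "block_flip k ** block_flip k = mat 1"
  unfolding vec_eq_iff block_flip_mult by (simp add: block_flip_def mat_def)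

lemma cadj_block_flip: "cadj (block_flip k) = block_flip k"
  by (simp add: vec_eq_iff block_flip_def cadj_def)

lemma is_bdiag_block_flip_commute:
  assumes "is_bdiag A"
  shows "block_flip k ** A = A ** block_flip k"
proof -
  have "A $ p $ q = 0" if "fst p \<noteq> fst q" for p q
    using assms that unfolding is_bdiag_def by (metis prod.collapse)
  then show ?thesis
    unfolding vec_eq_iff block_flip_mult mult_block_flip by fastforce
qed

section \<open>Quadratic forms and closure properties of block-diagonal matrices\<close>

lemma sum_UNIV_prod:
  "(\<Sum>p\<in>UNIV. f p) = (\<Sum>a\<in>UNIV. \<Sum>b\<in>UNIV. f (a :: 'a::finite, b :: 'b::finite))"
  by (simp add: sum.cartesian_product)

lemma qform_bdiag:
  assumes "is_bdiag A"
  shows "qform A x = (\<Sum>k\<in>UNIV. qform (dblock A k) (\<chi> i. x $ (k, i)))"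
proof -
  have "(A *v x) $ (k, i) = (dblock A k *v (\<chi> i. x $ (k, i))) $ i" for k i
  proof -
    have "(A *v x) $ (k, i) = (\<Sum>k'\<in>UNIV. \<Sum>j\<in>UNIV. A $ (k, i) $ (k', j) * x $ (k', j))"
      by (simp add: matrix_vector_mult_def sum_UNIV_prod)
    also have "\<dots> = (\<Sum>k'\<in>{k}. \<Sum>j\<in>UNIV. A $ (k, i) $ (k', j) * x $ (k', j))"
      using assms by (intro sum.mono_neutral_right) (auto simp: is_bdiag_def)
    finally show ?thesis by (simp add: matrix_vector_mult_def dblock_def)
  qed
  then show ?thesis
    by (simp add: qform_def sum_UNIV_prod)
qed

lemma psd_bdiag:
  assumes "is_bdiag A" "\<And>k. psd (dblock A k)"
  shows "psd A"
  using assms(2) unfolding psd_def qform_bdiag[OF assms(1)] by (auto intro!: sum_nonneg sum_in_Reals)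

lemma is_bdiag_mat_1: "is_bdiag (mat 1)"
  by (simp add: is_bdiag_def mat_def)

lemma is_bdiag_add: "is_bdiag A \<Longrightarrow> is_bdiag B \<Longrightarrow> is_bdiag (A + B)"
  by (simp add: is_bdiag_def)

lemma is_bdiag_scaleR: "is_bdiag A \<Longrightarrow> is_bdiag (r *\<^sub>R A)"
  by (simp add: is_bdiag_def)

lemma is_bdiag_sum: "(\<And>i. i \<in> I \<Longrightarrow> is_bdiag (A i)) \<Longrightarrow> is_bdiag (\<Sum>i\<in>I. A i)"
  by (simp add: is_bdiag_def)

text \<open>The joint law is a product, so invariance of each factor suffices. The same
  \<open>D\<close> acts on signal and noise, so that it also acts on their sum.\<close>

lemma distr_pair_cgauss_involution:
  fixes R S D :: "complex ^ 'n::finite ^ 'n" and p :: "'a pmf"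
  assumes RS: "psd R" "psd S"
    and D: "D ** D = mat 1" "cadj D = D" "D ** R = R ** D" "D ** S = S ** D"
  defines "M \<equiv> measure_pmf p \<Otimes>\<^sub>M (cgauss R \<Otimes>\<^sub>M cgauss S)"
  shows "distr M M (\<lambda>(a, h, v). (a, D *v h, D *v v)) = M"
proof -
  interpret R: finite_measure "cgauss R" by (rule finite_measure_cgauss)
  interpret S: finite_measure "cgauss S" by (rule finite_measure_cgauss)
  interpret RS: pair_sigma_finite "cgauss R" "cgauss S" ..
  note dR = distr_cgauss_involution[OF psd_factorization[OF RS(1)] D(1,2,3)]
  note dS = distr_cgauss_involution[OF psd_factorization[OF RS(2)] D(1,2,4)]
  have [measurable]: "(*v) D \<in> measurable (cgauss R) (cgauss R)" "(*v) D \<in> measurable (cgauss S) (cgauss S)"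
    by simp_all
  \<comment> \<open>The target is changed from \<open>borel\<close> to a measure with the same sets,
    the form that matches the product rule for \<open>distr\<close>.\<close>
  have dR': "distr (cgauss R) (cgauss R) ((*v) D) = cgauss R"
    using dR by (simp cong: distr_cong)
  have dS': "distr (cgauss S) (cgauss S) ((*v) D) = cgauss S"
    using dS by (simp cong: distr_cong)
  let ?N = "cgauss R \<Otimes>\<^sub>M cgauss S"
  let ?f = "\<lambda>(h, v). (D *v h, D *v v)"
  have dN: "distr ?N ?N ?f = ?N"
    using pair_measure_distr[of "(*v) D" "cgauss R" "cgauss R" "(*v) D" "cgauss S" "cgauss S"]
      S.sigma_finite_measure_axioms by (simp add: dR' dS')
  have "distr (measure_pmf p) (measure_pmf p) (\<lambda>a. a) \<Otimes>\<^sub>M distr ?N ?N ?f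
      = distr M M (\<lambda>(a, w). (a, ?f w))"
    unfolding M_def
    by (rule pair_measure_distr) (simp_all add: dN RS.sigma_finite_measure_axioms)
  then show ?thesis
    unfolding dN by (simp add: M_def case_prod_unfold)
qed

text \<open>For an entry joining different blocks \<open>k\<close> and \<open>k'\<close>, flipping
  block \<open>k\<close> preserves the law but negates the integrand's entry, so its integral equals
  its own negative.\<close>

lemma is_bdiag_se_err:
  fixes R S :: "complex ^ ('k::finite \<times> 'm::finite) ^ ('k \<times> 'm)"
  assumes RS: "psd R" "psd S" "is_bdiag R" "is_bdiag S"
    and inv: "invertible S" "invertible (R + S)"
  shows "is_bdiag (se_err eps R S)"
proof -
  define M where "M = measure_pmf (bernoulli_pmf eps) \<Otimes>\<^sub>M (cgauss R \<Otimes>\<^sub>M cgauss S)"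
  define F where "F = (\<lambda>(a, h, v). let x = (if a then h else 0)
    in outer (mmse_g eps R S (x + v) - x))"
  have err: "se_err eps R S = integral\<^sup>L M F"
    by (simp add: se_err_def M_def F_def)
  show ?thesis
  proof (cases "integrable M F")
    case False
    then show ?thesis by (simp add: err not_integrable_integral_eq is_bdiag_def)
  next
    case True
    have "integral\<^sup>L M F $ (k, i) $ (k', j) = 0" if "k \<noteq> k'" for k k' i j
    proof -
      let ?D = "block_flip k"
      let ?\<Phi> = "\<lambda>(a, h, v). (a, ?D *v h, ?D *v v)"
      let ?entry = "\<lambda>A::complex ^ ('k \<times> 'm) ^ ('k \<times> 'm). A $ (k, i) $ (k', j)"
      note D = block_flip_involution[of k] cadj_block_flip[of k]
        is_bdiag_block_flip_commute[OF RS(3), of k] is_bdiag_block_flip_commute[OF RS(4), of k]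
      note lin = linear_matrix_vector_mult_complex[of ?D]
      have flip: "?entry (F (?\<Phi> w)) = - ?entry (F w)" for w
      proof -
        obtain a h v where w: "w = (a, h, v)" by (metis prod_cases3)
        define x where "x = (if a then h else 0)"
        define y where "y = mmse_g eps R S (x + v) - x"
        \<comment> \<open>The inactive value 0 is fixed by the flip, so activity masking commutes
          with it.\<close>
        have Dx: "(if a then ?D *v h else 0) = ?D *v x"
          by (simp add: x_def)
        have "mmse_g eps R S (?D *v x + ?D *v v) - ?D *v x = ?D *v y"
          using mmse_g_involution[OF D inv, of eps "x + v"]
          by (simp add: y_def linear_add[OF lin] linear_diff[OF lin])
        then have "F (?\<Phi> w) = outer (?D *v y)"
          by (simp add: F_def w Dx)
        moreover have "F w = outer y"
          by (simp add: F_def w x_def y_def)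
        \<comment> \<open>The row index lies in block \<open>k\<close> and the column index does
          not, so exactly one factor of the outer product changes sign.\<close>
        ultimately show ?thesis
          using that by (simp add: outer_def block_flip_mult_vec)
      qed
      have "linear ?entry"
        by (rule linearI) simp_all
      then have bl: "bounded_linear ?entry"
        by (simp add: linear_conv_bounded_linear)
      have int: "integrable M (\<lambda>w. ?entry (F w))"
        using integrable_bounded_linear[OF bl True] .
      have \<Phi>: "?\<Phi> \<in> measurable M M"
        unfolding M_def by measurable
      have "(\<integral>w. ?entry (F w) \<partial>M) = (\<integral>w. ?entry (F w) \<partial>distr M M ?\<Phi>)"
        unfolding M_def distr_pair_cgauss_involution[OF RS(1,2) D] ..
      also have "\<dots> = (\<integral>w. ?entry (F (?\<Phi> w)) \<partial>M)"
        using int by (intro integral_distr[OF \<Phi>]) simp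
      also have "\<dots> = - (\<integral>w. ?entry (F w) \<partial>M)"
        by (simp only: flip integral_minus)
      finally have "(\<integral>w. ?entry (F w) \<partial>M) = 0"
        by simp
      then show ?thesis
        using integral_bounded_linear[OF bl True] by simp
    qed
    then show ?thesis by (simp add: err is_bdiag_def)
  qed
qed

theorem theorem1:
  fixes N L :: nat
    and sig2 :: real
    and eps :: "nat \<Rightarrow> real"
    and R :: "nat \<Rightarrow> complex ^ ('k::finite \<times> 'm::finite) ^ ('k \<times> 'm)"
  assumes "N > 0" and "L > 0" and "sig2 > 0"
    and "\<forall>n\<in>{1..N}. 0 < eps n \<and> eps n < 1"
    and "\<forall>n\<in>{1..N}. is_bdiag (R n)"
    and "\<forall>n\<in>{1..N}. \<forall>k. hermitian (dblock (R n) k) \<and> psd (dblock (R n) k)"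
  shows "\<forall>t. is_bdiag (se_Sigma sig2 L N eps R t)"
proof -
  have R: "is_bdiag (R n)" "psd (R n)" if "n \<in> {1..N}" for n
    using assms(5,6) that psd_bdiag by blast+
  \<comment> \<open>The induction is strengthened: splitting off the positive multiple of the
    identity keeps both \<open>?S\<close> and \<open>R n + ?S\<close> invertible, as equivariance of
    the denoiser requires.\<close>
  have "\<exists>P. psd P \<and> is_bdiag P \<and> se_Sigma sig2 L N eps R t = sig2 *\<^sub>R mat 1 + P" for t
  proof (induction t)
    case 0
    have "psd ((1 / real L) *\<^sub>R (\<Sum>n\<in>{1..N}. R n))" "is_bdiag ((1 / real L) *\<^sub>R (\<Sum>n\<in>{1..N}. R n))"
      using R by (auto intro!: psd_scaleR psd_sum is_bdiag_scaleR is_bdiag_sum)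
    then show ?case by auto
  next
    case (Suc t)
    let ?S = "se_Sigma sig2 L N eps R t"
    obtain P where P: "psd P" "is_bdiag P" "?S = sig2 *\<^sub>R mat 1 + P"
      using Suc.IH by blast
    have "psd (mat 1 :: complex ^ ('k \<times> 'm) ^ ('k \<times> 'm))"
      by (simp add: psd_def qform_mat_1)
    then have S: "psd ?S" "is_bdiag ?S"
      unfolding P(3) using P(1,2) assms(3)
      by (auto intro!: psd_add psd_scaleR is_bdiag_add is_bdiag_scaleR is_bdiag_mat_1)
    have invS: "invertible ?S"
      unfolding P(3) using assms(3) P(1) by (rule invertible_scaled_mat_1_plus_psd)
    have "is_bdiag (se_err (eps n) (R n) ?S)" if n: "n \<in> {1..N}" for n
    proof -
      \<comment> \<open>Regrouping exhibits the sum as a positive multiple of the identity plus a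
        positive semidefinite matrix.\<close>
      have "R n + ?S = sig2 *\<^sub>R mat 1 + (R n + P)"
        by (simp add: P(3))
      then have "invertible (R n + ?S)"
        using invertible_scaled_mat_1_plus_psd[OF assms(3) psd_add[OF R(2)[OF n] P(1)]] by (simp only:)
      then show ?thesis
        using is_bdiag_se_err[OF R(2)[OF n] S(1) R(1)[OF n] S(2) invS] by blast
    qed
    then have "psd ((1 / real L) *\<^sub>R (\<Sum>n\<in>{1..N}. se_err (eps n) (R n) ?S))"
      "is_bdiag ((1 / real L) *\<^sub>R (\<Sum>n\<in>{1..N}. se_err (eps n) (R n) ?S))"
      by (auto intro!: psd_scaleR psd_sum psd_se_err is_bdiag_scaleR is_bdiag_sum)
    then show ?case by auto
  qed
  then show ?thesis
    by (metis is_bdiag_add is_bdiag_mat_1 is_bdiag_scaleR)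
qed

end
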